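(* Let $V$ be a finite-dimensional complex vector space, let $d\ge 1$ and let $F\in S^dV$. If $F$ is a direct sum, then the apolar ideal $F^\perp$ has a minimal generator of degree $d=\deg F$.
   Context: Fix a basis $x_1,\dots,x_n$ of $V$, let $S=\mathbb{C}[x_1,\dots,x_n]=\bigoplus_d S^dV$ and let $T=\mathbb{C}[\alpha_1,\dots,\alpha_n]$ be the dual ring, with $\alpha_1,\dots,\alpha_n$ the dual basis of $V^*$. $T$ acts on $S$ by letting $\alpha_i$ act as $\partial/\partial x_i$; write $\Theta\circ F$ for this action. The apolar ideal of a form $F$ is $F^\perp=\{\Theta\in T:\Theta\circ F=0\}$, a homogeneous ideal of $T$. A form $F\in S^dV$ is a direct sum if there are subspaces $V_1,V_2\subset V$ with $V=V_1\oplus V_2$ and nonzero $F_1\in S^dV_1$, $F_2\in S^dV_2$ such that $F=F_1+F_2$. For a homogeneous ideal $I\subset T$ and $\mathfrak m=\langle\alpha_1,\dots,\alpha_n\rangle$, a minimal generator of $I$ of degree $k$ is a nonzero element of $(I/\mathfrak m I)_k$; so "$I$ has a minimal generator of degree $k$" means $(I/\mathfrak m I)_k\neq 0$. *)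

theory Defs
  imports Complex_Main "HOL-Library.Poly_Mapping" "HOL-Algebra.QuotRing" "HOL-Algebra.Ideal_Product"
begin

section \<open>Polynomial rings indexed by a basis\<close>

text \<open>
  A monomial is a finitely supported exponent function, a polynomial a finitely supported
  coefficient function on monomials. The vector space \<open>V\<close> is the type \<open>'v\<close> with scalar
  multiplication \<open>scale\<close>, and the indeterminates are indexed by the elements of a chosen
  basis \<open>B\<close> of \<open>V\<close>. The rings \<open>S = \<complex>[x\<^sub>b : b \<in> B]\<close> and \<open>T = \<complex>[\<alpha>\<^sub>b : b \<in> B]\<close> share one
  carrier: \<open>Var b\<close> is the basis vector \<open>x\<^sub>b\<close> of \<open>V\<close> when read in \<open>S\<close>, and the dual basis
  vector \<open>\<alpha>\<^sub>b\<close> when read in \<open>T\<close>.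
\<close>

type_synonym 'v cpoly = "('v \<Rightarrow>\<^sub>0 nat) \<Rightarrow>\<^sub>0 complex"

definition Cst :: "complex \<Rightarrow> 'v cpoly"
  where "Cst c = Poly_Mapping.single 0 c"

definition Var :: "'v \<Rightarrow> 'v cpoly"
  where "Var b = Poly_Mapping.single (Poly_Mapping.single b 1) 1"

definition poly_ring :: "'v set \<Rightarrow> 'v cpoly ring"
  where "poly_ring B =
    \<lparr>carrier = {p. \<forall>m\<in>Poly_Mapping.keys p. Poly_Mapping.keys m \<subseteq> B},
     mult = (*), one = 1, zero = 0, add = (+)\<rparr>"

definition mon_deg :: "('v \<Rightarrow>\<^sub>0 nat) \<Rightarrow> nat"
  where "mon_deg m = (\<Sum>i\<in>Poly_Mapping.keys m. Poly_Mapping.lookup m i)"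

definition homog :: "'v set \<Rightarrow> nat \<Rightarrow> 'v cpoly set"
  where "homog B k = {p \<in> carrier (poly_ring B). \<forall>m\<in>Poly_Mapping.keys p. mon_deg m = k}"


section \<open>Symmetric powers and direct sums\<close>

text \<open>The element of \<open>S\<close> of degree 1 that corresponds to \<open>v \<in> V\<close>.\<close>

definition lin_form :: "(complex \<Rightarrow> 'v::ab_group_add \<Rightarrow> 'v) \<Rightarrow> 'v set \<Rightarrow> 'v \<Rightarrow> 'v cpoly"
  where "lin_form scale B v = (\<Sum>b\<in>B. Cst (module.representation scale B v b) * Var b)"

text \<open>
  For a subspace \<open>W\<close> of \<open>V\<close>, the space \<open>S\<^sup>dW\<close> as a subspace of \<open>S\<close>: the complex span of all
  \<open>d\<close>-fold products of elements of \<open>W\<close>. For \<open>W = V\<close> this is the degree \<open>d\<close> part of \<open>S\<close>,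
  see \<open>sym_pow_UNIV\<close> below.
\<close>

definition sym_pow ::
  "(complex \<Rightarrow> 'v::ab_group_add \<Rightarrow> 'v) \<Rightarrow> 'v set \<Rightarrow> nat \<Rightarrow> 'v set \<Rightarrow> 'v cpoly set"
  where "sym_pow scale B d W =
    module.span (\<lambda>c p. Cst c * p) {\<Prod>i<d. lin_form scale B (w i) | w. \<forall>i<d. w i \<in> W}"

definition is_direct_sum ::
  "(complex \<Rightarrow> 'v::ab_group_add \<Rightarrow> 'v) \<Rightarrow> 'v set \<Rightarrow> nat \<Rightarrow> 'v cpoly \<Rightarrow> bool"
  where "is_direct_sum scale B d F \<longleftrightarrow>
    (\<exists>V1 V2. module.subspace scale V1 \<and> module.subspace scale V2 \<and>
       V1 \<inter> V2 = {0} \<and> {v1 + v2 | v1 v2. v1 \<in> V1 \<and> v2 \<in> V2} = UNIV \<and>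
       (\<exists>F1 F2. F1 \<in> sym_pow scale B d V1 \<and> F1 \<noteq> 0 \<and>
                F2 \<in> sym_pow scale B d V2 \<and> F2 \<noteq> 0 \<and> F = F1 + F2))"


section \<open>The apolarity action\<close>

definition pd :: "'v \<Rightarrow> 'v cpoly \<Rightarrow> 'v cpoly"
  where "pd i F = (\<Sum>m\<in>Poly_Mapping.keys F.
    Poly_Mapping.single (m - Poly_Mapping.single i 1)
      (of_nat (Poly_Mapping.lookup m i) * Poly_Mapping.lookup F m))"

text \<open>
  The action of a monomial of \<open>T\<close> as the composition of iterated partial derivatives. The
  order of composition is irrelevant by \<open>comp_fun_commute_pd\<close> below.
\<close>

definition mon_act :: "('v \<Rightarrow>\<^sub>0 nat) \<Rightarrow> 'v cpoly \<Rightarrow> 'v cpoly"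
  where "mon_act m F =
    Finite_Set.fold (\<lambda>i. pd i ^^ Poly_Mapping.lookup m i) F (Poly_Mapping.keys m)"

definition act :: "'v cpoly \<Rightarrow> 'v cpoly \<Rightarrow> 'v cpoly"  (infixr \<open>\<bullet>\<^sub>T\<close> 75)
  where "\<Theta> \<bullet>\<^sub>T F = (\<Sum>m\<in>Poly_Mapping.keys \<Theta>. Cst (Poly_Mapping.lookup \<Theta> m) * mon_act m F)"

definition apolar :: "'v set \<Rightarrow> 'v cpoly \<Rightarrow> 'v cpoly set"
  where "apolar B F = {\<Theta> \<in> carrier (poly_ring B). \<Theta> \<bullet>\<^sub>T F = 0}"


section \<open>Minimal generators\<close>

definition irr_ideal :: "'v set \<Rightarrow> 'v cpoly set"
  where "irr_ideal B = genideal (poly_ring B) (Var ` B)"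

abbreviation m_times :: "'v set \<Rightarrow> 'v cpoly set \<Rightarrow> 'v cpoly set"
  where "m_times B I \<equiv> ideal_prod (poly_ring B) (irr_ideal B) I"

text \<open>
  For a homogeneous ideal \<open>I\<close>, the degree \<open>k\<close> part of \<open>I / \<mm>I\<close>, as a set of cosets of
  \<open>\<mm>I\<close> in \<open>T\<close>: the image of the degree \<open>k\<close> part of \<open>I\<close>. The zero coset is \<open>\<mm>I\<close>, the
  zero of the quotient ring \<open>T / \<mm>I\<close>.
\<close>

definition gen_space :: "'v set \<Rightarrow> 'v cpoly set \<Rightarrow> nat \<Rightarrow> 'v cpoly set set"
  where "gen_space B I k = (\<lambda>\<Theta>. m_times B I +>\<^bsub>poly_ring B\<^esub> \<Theta>) ` (I \<inter> homog B k)"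

definition has_minimal_generator :: "'v set \<Rightarrow> 'v cpoly set \<Rightarrow> nat \<Rightarrow> bool"
  where "has_minimal_generator B I k \<longleftrightarrow>
    (\<exists>g \<in> gen_space B I k. g \<noteq> \<zero>\<^bsub>poly_ring B Quot m_times B I\<^esub>)"


section \<open>Basic facts that confirm the definitions\<close>

subsection \<open>The polynomial ring\<close>

lemma Cst_simps [simp]: "Cst 0 = 0" "Cst 1 = 1"
  by (simp_all add: Cst_def)

lemma Cst_add: "Cst (a + b) = Cst a + Cst b"
  by (simp add: Cst_def single_add)

lemma Cst_mult: "Cst (a * b) = Cst a * Cst b"
  by (simp add: Cst_def mult_single)

lemma Cst_times_single: "Cst c * Poly_Mapping.single m a = Poly_Mapping.single m (c * a)"
  by (simp add: Cst_def mult_single)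

lemma lookup_Cst_times: "Poly_Mapping.lookup (Cst c * p) m = c * Poly_Mapping.lookup p m"
  by (simp add: Cst_def flip: mult_map_scale_conv_mult) (simp add: map.rep_eq when_def)

lemma poly_as_sum:
  fixes p :: "'v cpoly"
  shows "p = (\<Sum>m\<in>Poly_Mapping.keys p. Poly_Mapping.single m (Poly_Mapping.lookup p m))"
  by (rule poly_mapping_eqI)
     (auto simp: lookup_sum lookup_single when_def in_keys_iff)

lemma vector_space_cpoly: "vector_space (\<lambda>c (p :: 'v cpoly). Cst c * p)"
  by unfold_locales (simp_all add: algebra_simps Cst_add Cst_mult)

lemma poly_ring_simps:
  "x \<otimes>\<^bsub>poly_ring B\<^esub> y = x * y" "x \<oplus>\<^bsub>poly_ring B\<^esub> y = x + y"
  "\<one>\<^bsub>poly_ring B\<^esub> = 1" "\<zero>\<^bsub>poly_ring B\<^esub> = 0"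
  by (simp_all add: poly_ring_def)

lemma cring_poly_ring: "cring (poly_ring B)"
proof (rule cringI)
  show "abelian_group (poly_ring B)"
  proof (rule abelian_groupI)
    fix x y assume "x \<in> carrier (poly_ring B)" "y \<in> carrier (poly_ring B)"
    then show "x \<oplus>\<^bsub>poly_ring B\<^esub> y \<in> carrier (poly_ring B)"
      using keys_add[of x y] by (auto simp: poly_ring_def)
  next
    fix x assume "x \<in> carrier (poly_ring B)"
    then show "\<exists>y\<in>carrier (poly_ring B). y \<oplus>\<^bsub>poly_ring B\<^esub> x = \<zero>\<^bsub>poly_ring B\<^esub>"
      by (auto simp: poly_ring_def in_keys_iff intro!: exI[of _ "- x"])
  qed (auto simp: poly_ring_def algebra_simps)
next
  have closed: "x * y \<in> carrier (poly_ring B)"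
    if x: "x \<in> carrier (poly_ring B)" and y: "y \<in> carrier (poly_ring B)" for x y
  proof -
    have "Poly_Mapping.keys m \<subseteq> B" if mem: "m \<in> Poly_Mapping.keys (x * y)" for m
    proof -
      obtain a b where ab: "m = a + b" "a \<in> Poly_Mapping.keys x" "b \<in> Poly_Mapping.keys y"
        using subsetD[OF keys_mult mem] by auto
      then have "Poly_Mapping.keys a \<subseteq> B" "Poly_Mapping.keys b \<subseteq> B"
        using x y by (auto simp: poly_ring_def)
      then show ?thesis unfolding ab(1) by (intro subset_trans[OF keys_add]) simp
    qed
    then show ?thesis by (simp add: poly_ring_def)
  qed
  show "Group.comm_monoid (poly_ring B)"
  proof (rule comm_monoidI)
    show "x \<otimes>\<^bsub>poly_ring B\<^esub> y \<in> carrier (poly_ring B)"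
      if "x \<in> carrier (poly_ring B)" "y \<in> carrier (poly_ring B)" for x y
      using closed[OF that] by (simp add: poly_ring_def)
  qed (simp_all add: poly_ring_def mult_ac)
qed (auto simp: poly_ring_def algebra_simps)


subsection \<open>The action\<close>

lemma lookup_pd:
  "Poly_Mapping.lookup (pd i F) m =
     of_nat (Suc (Poly_Mapping.lookup m i)) * Poly_Mapping.lookup F (m + Poly_Mapping.single i 1)"
proof -
  let ?e = "Poly_Mapping.single i (1::nat)"
  have *: "Poly_Mapping.lookup (Poly_Mapping.single (k - ?e)
             (of_nat (Poly_Mapping.lookup k i) * Poly_Mapping.lookup F k)) m =
           (if k = m + ?e
            then of_nat (Suc (Poly_Mapping.lookup m i)) * Poly_Mapping.lookup F k else 0)" for k
  proof (cases "Poly_Mapping.lookup k i = 0")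
    case True
    then have "k \<noteq> m + ?e" by (auto simp: lookup_add)
    with True show ?thesis by simp
  next
    case False
    then have k: "(k - ?e) + ?e = k"
      by (intro poly_mapping_eqI) (auto simp: lookup_add lookup_minus lookup_single when_def)
    have "k - ?e = m \<longleftrightarrow> k = m + ?e"
    proof
      assume "k - ?e = m"
      with k show "k = m + ?e" by metis
    qed simp
    then show ?thesis by (auto simp: lookup_single when_def lookup_add)
  qed
  show ?thesis
    unfolding pd_def lookup_sum * by (simp add: in_keys_iff)
qed

lemma pd_add: "pd i (F + G) = pd i F + pd i G"
  by (rule poly_mapping_eqI) (simp add: lookup_pd lookup_add algebra_simps)

lemma pd_Cst_times: "pd i (Cst c * F) = Cst c * pd i F"
  by (rule poly_mapping_eqI) (simp only: lookup_pd lookup_Cst_times mult.left_commute)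

lemma pd_zero [simp]: "pd i 0 = 0"
  by (simp add: pd_def)

lemma pd_sum: "pd i (sum f A) = (\<Sum>a\<in>A. pd i (f a))"
  by (induction A rule: infinite_finite_induct) (simp_all add: pd_add)

lemma pd_single:
  "pd i (Poly_Mapping.single m c) =
     Poly_Mapping.single (m - Poly_Mapping.single i 1) (of_nat (Poly_Mapping.lookup m i) * c)"
  by (cases "c = 0") (simp_all add: pd_def)

lemma pd_Var: "pd i (Var j) = (if i = j then 1 else 0)"
  by (simp add: Var_def pd_single lookup_single when_def)

lemma pd_mult: "pd i (F * G) = pd i F * G + F * pd i G"
proof -
  let ?e = "Poly_Mapping.single i (1::nat)"
  have mon: "pd i (Poly_Mapping.single m a * Poly_Mapping.single n b) =
      pd i (Poly_Mapping.single m a) * Poly_Mapping.single n b +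
      Poly_Mapping.single m a * pd i (Poly_Mapping.single n b)" for m n and a b :: complex
  proof -
    have l: "n + (m - ?e) = m + n - ?e" if "Poly_Mapping.lookup m i \<noteq> 0"
      using that
      by (intro poly_mapping_eqI) (auto simp: lookup_add lookup_minus lookup_single when_def)
    have r: "m + (n - ?e) = m + n - ?e" if "Poly_Mapping.lookup n i \<noteq> 0"
      using that
      by (intro poly_mapping_eqI) (auto simp: lookup_add lookup_minus lookup_single when_def)
    show ?thesis
      by (cases "Poly_Mapping.lookup m i = 0"; cases "Poly_Mapping.lookup n i = 0")
         (simp_all add: pd_single mult_single lookup_add l[simplified] r[simplified] algebra_simps
           flip: single_add)
  qed
  have FG: "F * G = (\<Sum>m\<in>Poly_Mapping.keys F. \<Sum>n\<in>Poly_Mapping.keys G.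
      Poly_Mapping.single m (Poly_Mapping.lookup F m) *
      Poly_Mapping.single n (Poly_Mapping.lookup G n))"
    by (subst (1) poly_as_sum[of F], subst (1) poly_as_sum[of G]) (simp add: sum_product)
  have dF: "pd i F = (\<Sum>m\<in>Poly_Mapping.keys F.
      pd i (Poly_Mapping.single m (Poly_Mapping.lookup F m)))" for F :: "'a cpoly"
    by (subst poly_as_sum[of F]) (simp add: pd_sum)
  have "pd i F * G + F * pd i G =
      (\<Sum>m\<in>Poly_Mapping.keys F. pd i (Poly_Mapping.single m (Poly_Mapping.lookup F m))) *
      (\<Sum>n\<in>Poly_Mapping.keys G. Poly_Mapping.single n (Poly_Mapping.lookup G n)) +
      (\<Sum>m\<in>Poly_Mapping.keys F. Poly_Mapping.single m (Poly_Mapping.lookup F m)) *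
      (\<Sum>n\<in>Poly_Mapping.keys G. pd i (Poly_Mapping.single n (Poly_Mapping.lookup G n)))"
    by (simp only: dF[symmetric] poly_as_sum[symmetric])
  then show ?thesis
    unfolding FG pd_sum mon by (simp add: sum_product sum.distrib)
qed

lemma pd_commute: "pd i (pd j F) = pd j (pd i F)"
proof (cases "i = j")
  case False
  then show ?thesis
    by (intro poly_mapping_eqI)
       (simp add: lookup_pd lookup_add lookup_single when_def add_ac mult_ac)
qed simp

lemma funpow_pd_commute: "(pd i ^^ a) ((pd j ^^ b) F) = (pd j ^^ b) ((pd i ^^ a) F)"
proof -
  have "pd i ((pd j ^^ b) F) = (pd j ^^ b) (pd i F)" for F
    by (induction b) (simp_all add: pd_commute[of i j])
  then show ?thesis by (induction a) simp_all
qed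

lemma comp_fun_commute_pd: "comp_fun_commute (\<lambda>i. pd i ^^ e i)"
proof
  show "(pd y ^^ e y) \<circ> (pd x ^^ e x) = (pd x ^^ e x) \<circ> (pd y ^^ e y)" for x y :: 'a
    by (rule ext) (simp add: funpow_pd_commute[where i = y])
qed

lemma mon_act_fold:
  assumes "finite A" "Poly_Mapping.keys m \<subseteq> A"
  shows "mon_act m F = Finite_Set.fold (\<lambda>i. pd i ^^ Poly_Mapping.lookup m i) F A"
proof -
  interpret comp_fun_commute "\<lambda>i. pd i ^^ Poly_Mapping.lookup m i"
    by (rule comp_fun_commute_pd)
  have *: "finite C \<Longrightarrow> C \<inter> Poly_Mapping.keys m = {} \<Longrightarrow>
    Finite_Set.fold (\<lambda>i. pd i ^^ Poly_Mapping.lookup m i) F (Poly_Mapping.keys m \<union> C) =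
      mon_act m F" for C
    by (induction C rule: finite_induct) (auto simp: mon_act_def in_keys_iff)
  have "(A - Poly_Mapping.keys m) \<inter> Poly_Mapping.keys m = {}"
    and A: "Poly_Mapping.keys m \<union> (A - Poly_Mapping.keys m) = A"
    using assms(2) by blast+
  with *[of "A - Poly_Mapping.keys m"] assms(1) show ?thesis
    unfolding A by (simp only: finite_Diff simp_thms)
qed

lemma mon_act_zero [simp]: "mon_act 0 F = F"
  by (simp add: mon_act_def)

lemma mon_act_single: "mon_act (Poly_Mapping.single i 1) F = pd i F"
proof -
  interpret comp_fun_commute "\<lambda>j. pd j ^^ Poly_Mapping.lookup (Poly_Mapping.single i 1) j"
    by (rule comp_fun_commute_pd)
  show ?thesis using fold_insert[of "{}" i F] by (simp add: mon_act_def)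
qed

lemma mon_act_plus: "mon_act (m + n) F = mon_act m (mon_act n F)"
proof -
  let ?f = "\<lambda>m i. pd i ^^ Poly_Mapping.lookup m i"
  interpret m: comp_fun_commute "?f m" by (rule comp_fun_commute_pd)
  interpret n: comp_fun_commute "?f n" by (rule comp_fun_commute_pd)
  interpret mn: comp_fun_commute "?f (m + n)" by (rule comp_fun_commute_pd)
  have 3: "(pd i ^^ a) (Finite_Set.fold (?f m) G A) = Finite_Set.fold (?f m) ((pd i ^^ a) G) A"
    if "finite A" for i a G A
    using that by (induction A rule: finite_induct) 
      (simp_all add: funpow_pd_commute[where i = i and a = a])
  have *: "Finite_Set.fold (?f (m + n)) F A =
      Finite_Set.fold (?f m) (Finite_Set.fold (?f n) F A) A" if "finite A" for A
    using that
  proof (induction A rule: finite_induct)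
    case (insert x A)
    let ?G = "Finite_Set.fold (?f n) F A"
    have "Finite_Set.fold (?f (m + n)) F (insert x A) =
        ?f (m + n) x (Finite_Set.fold (?f (m + n)) F A)"
      by (rule mn.fold_insert[OF insert.hyps])
    also have "\<dots> = ?f m x (?f n x (Finite_Set.fold (?f m) ?G A))"
      unfolding insert.IH by (simp add: lookup_add funpow_add)
    also have "\<dots> = Finite_Set.fold (?f m) (Finite_Set.fold (?f n) F (insert x A)) (insert x A)"
      using insert.hyps by (simp add: 3)
    finally show ?case .
  qed simp
  let ?A = "Poly_Mapping.keys m \<union> Poly_Mapping.keys n"
  show ?thesis
    using *[of ?A] keys_add[of m n] by (simp add: mon_act_fold[of ?A])
qed

lemma mon_act_linear:
  "mon_act m (F + G) = mon_act m F + mon_act m G"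
  "mon_act m (Cst c * F) = Cst c * mon_act m F"
proof -
  let ?f = "\<lambda>i. pd i ^^ Poly_Mapping.lookup m i"
  interpret comp_fun_commute ?f by (rule comp_fun_commute_pd)
  have a: "(pd i ^^ a) (F + G) = (pd i ^^ a) F + (pd i ^^ a) G" for i a and F G :: "'a cpoly"
    by (induction a) (simp_all add: pd_add)
  have c: "(pd i ^^ a) (Cst c * F) = Cst c * (pd i ^^ a) F" for i a c and F :: "'a cpoly"
    by (induction a) (simp_all add: pd_Cst_times)
  have "Finite_Set.fold ?f (F + G) A = Finite_Set.fold ?f F A + Finite_Set.fold ?f G A"
    "Finite_Set.fold ?f (Cst c * F) A = Cst c * Finite_Set.fold ?f F A" if "finite A" for A
    using that by (induction A rule: finite_induct; simp add: a c)+
  then show "mon_act m (F + G) = mon_act m F + mon_act m G"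
    "mon_act m (Cst c * F) = Cst c * mon_act m F"
    by (simp_all add: mon_act_def)
qed

lemma mon_act_of_zero [simp]: "mon_act m 0 = 0"
  using mon_act_linear(2)[of m 0 0] by simp

lemma act_superset:
  assumes "finite A" "Poly_Mapping.keys \<Theta> \<subseteq> A"
  shows "\<Theta> \<bullet>\<^sub>T F = (\<Sum>m\<in>A. Cst (Poly_Mapping.lookup \<Theta> m) * mon_act m F)"
  unfolding act_def using assms by (intro sum.mono_neutral_left) (auto simp: in_keys_iff)

lemma act_add_left: "(\<Theta> + \<Psi>) \<bullet>\<^sub>T F = \<Theta> \<bullet>\<^sub>T F + \<Psi> \<bullet>\<^sub>T F"
proof -
  let ?A = "Poly_Mapping.keys \<Theta> \<union> Poly_Mapping.keys \<Psi>"
  show ?thesis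
    using keys_add[of \<Theta> \<Psi>]
    by (simp add: act_superset[of ?A] lookup_add Cst_add algebra_simps sum.distrib)
qed

lemma act_add_right: "\<Theta> \<bullet>\<^sub>T (F + G) = \<Theta> \<bullet>\<^sub>T F + \<Theta> \<bullet>\<^sub>T G"
  by (simp add: act_def mon_act_linear algebra_simps sum.distrib)

lemma act_Cst_right: "\<Theta> \<bullet>\<^sub>T (Cst c * F) = Cst c * (\<Theta> \<bullet>\<^sub>T F)"
  by (simp add: act_def mon_act_linear(2) sum_distrib_left mult.left_commute)

lemma act_zero [simp]: "0 \<bullet>\<^sub>T F = 0" "\<Theta> \<bullet>\<^sub>T 0 = 0"
  by (simp_all add: act_def)

lemma act_single: "Poly_Mapping.single m c \<bullet>\<^sub>T F = Cst c * mon_act m F"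
  by (cases "c = 0") (simp_all add: act_def)

lemma act_one [simp]: "1 \<bullet>\<^sub>T F = F"
  using act_single[of 0 1 F] by simp

lemma act_Cst: "Cst c \<bullet>\<^sub>T F = Cst c * F"
  by (simp add: Cst_def act_single)

lemma act_Var: "Var i \<bullet>\<^sub>T F = pd i F"
  using act_single[of "Poly_Mapping.single i 1" 1 F] by (simp add: Var_def mon_act_single[simplified])

lemma act_sum_left: "sum f A \<bullet>\<^sub>T F = (\<Sum>a\<in>A. f a \<bullet>\<^sub>T F)"
  by (induction A rule: infinite_finite_induct) (simp_all add: act_add_left)

lemma act_sum_right: "\<Theta> \<bullet>\<^sub>T sum f A = (\<Sum>a\<in>A. \<Theta> \<bullet>\<^sub>T f a)"
  by (induction A rule: infinite_finite_induct) (simp_all add: act_add_right)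

lemma act_mult: "(\<Theta> * \<Psi>) \<bullet>\<^sub>T F = \<Theta> \<bullet>\<^sub>T \<Psi> \<bullet>\<^sub>T F"
proof -
  have "(\<Theta> * \<Psi>) \<bullet>\<^sub>T F =
      (\<Sum>m\<in>Poly_Mapping.keys \<Theta>. \<Sum>n\<in>Poly_Mapping.keys \<Psi>.
        (Poly_Mapping.single m (Poly_Mapping.lookup \<Theta> m) *
         Poly_Mapping.single n (Poly_Mapping.lookup \<Psi> n)) \<bullet>\<^sub>T F)"
    by (subst poly_as_sum[of \<Theta>], subst poly_as_sum[of \<Psi>]) (simp add: sum_product act_sum_left)
  also have "\<dots> = (\<Sum>m\<in>Poly_Mapping.keys \<Theta>. \<Sum>n\<in>Poly_Mapping.keys \<Psi>.
      Poly_Mapping.single m (Poly_Mapping.lookup \<Theta> m) \<bullet>\<^sub>T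
      Poly_Mapping.single n (Poly_Mapping.lookup \<Psi> n) \<bullet>\<^sub>T F)"
    by (simp add: mult_single act_single mon_act_plus mon_act_linear Cst_mult mult.assoc)
  also have "\<dots> = \<Theta> \<bullet>\<^sub>T \<Psi> \<bullet>\<^sub>T F"
    by (subst (3) poly_as_sum[of \<Theta>], subst (3) poly_as_sum[of \<Psi>])
       (simp add: act_sum_left act_sum_right, rule sum.swap)
  finally show ?thesis .
qed

lemma ideal_apolar: "ideal (apolar B F) (poly_ring B)"
proof -
  interpret cring "poly_ring B" by (rule cring_poly_ring)
  have uminus: "\<Theta> \<in> apolar B F \<Longrightarrow> - \<Theta> \<in> apolar B F" for \<Theta>
    using act_add_left[of \<Theta> "- \<Theta>" F] by (auto simp: apolar_def poly_ring_def in_keys_iff)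
  show ?thesis
  proof (rule idealI)
    show "ring (poly_ring B)" by (rule ring_axioms)
    show "subgroup (apolar B F) (add_monoid (poly_ring B))"
    proof (rule add.subgroupI)
      fix \<Theta> assume T: "\<Theta> \<in> apolar B F"
      have "\<ominus>\<^bsub>poly_ring B\<^esub> \<Theta> = - \<Theta>"
        using T uminus[OF T]
        by (intro minus_equality) (auto simp: apolar_def poly_ring_def)
      then show "\<ominus>\<^bsub>poly_ring B\<^esub> \<Theta> \<in> apolar B F" using uminus[OF T] by simp
    next
      fix \<Theta> \<Psi> assume "\<Theta> \<in> apolar B F" "\<Psi> \<in> apolar B F"
      then show "\<Theta> \<oplus>\<^bsub>poly_ring B\<^esub> \<Psi> \<in> apolar B F"
        using add.m_closed[of \<Theta> \<Psi>] by (auto simp: apolar_def act_add_left poly_ring_def)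
    next
      have "0 \<in> apolar B F" by (simp add: apolar_def poly_ring_def)
      then show "apolar B F \<noteq> {}" by blast
    qed (auto simp: apolar_def)
  next
    fix \<Theta> \<Psi> assume *: "\<Theta> \<in> apolar B F" "\<Psi> \<in> carrier (poly_ring B)"
    show 1: "\<Psi> \<otimes>\<^bsub>poly_ring B\<^esub> \<Theta> \<in> apolar B F"
      using * m_closed[of \<Psi> \<Theta>] by (auto simp: apolar_def act_mult poly_ring_def)
    show "\<Theta> \<otimes>\<^bsub>poly_ring B\<^esub> \<Psi> \<in> apolar B F"
      using 1 by (simp add: poly_ring_def mult.commute)
  qed
qed


subsection \<open>Symmetric powers\<close>

lemma mon_deg_superset:
  assumes "finite A" "Poly_Mapping.keys m \<subseteq> A"
  shows "mon_deg m = (\<Sum>i\<in>A. Poly_Mapping.lookup m i)"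
  unfolding mon_deg_def using assms by (intro sum.mono_neutral_left) (auto simp: in_keys_iff)

lemma mon_deg_plus: "mon_deg (m + n) = mon_deg m + mon_deg n"
proof -
  let ?A = "Poly_Mapping.keys m \<union> Poly_Mapping.keys n"
  show ?thesis
    using keys_add[of m n] by (simp add: mon_deg_superset[of ?A] lookup_add sum.distrib)
qed

lemma homog_mult:
  assumes "p \<in> homog B k" "q \<in> homog B l"
  shows "p * q \<in> homog B (k + l)"
proof -
  interpret cring "poly_ring B" by (rule cring_poly_ring)
  have "p * q \<in> carrier (poly_ring B)"
    using m_closed[of p q] assms by (simp add: homog_def poly_ring_simps)
  moreover have "mon_deg m = k + l" if "m \<in> Poly_Mapping.keys (p * q)" for m
    using subsetD[OF keys_mult that] assms by (auto simp: homog_def mon_deg_plus)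
  ultimately show ?thesis by (simp add: homog_def)
qed

lemma subspace_homog: "module.subspace (\<lambda>c p. Cst c * p) (homog B k)"
proof -
  interpret vector_space "\<lambda>c (p :: 'a cpoly). Cst c * p" by (rule vector_space_cpoly)
  show ?thesis
  proof (rule subspaceI)
    show "p + q \<in> homog B k" if "p \<in> homog B k" "q \<in> homog B k" for p q
    proof -
      have "Poly_Mapping.keys m \<subseteq> B \<and> mon_deg m = k" if m: "m \<in> Poly_Mapping.keys (p + q)" for m
      proof -
        from m keys_add[of p q] have "m \<in> Poly_Mapping.keys p \<or> m \<in> Poly_Mapping.keys q"
          by blast
        with \<open>p \<in> homog B k\<close> \<open>q \<in> homog B k\<close> show ?thesis
          by (auto simp only: homog_def poly_ring_def mem_Collect_eq partial_object.simps)
      qed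
      then show ?thesis by (simp add: homog_def poly_ring_def)
    qed
  qed (auto simp: homog_def poly_ring_def in_keys_iff lookup_Cst_times)
qed

lemma lin_form_homog: "lin_form scale B v \<in> homog B 1"
proof -
  interpret vector_space "\<lambda>c (p :: 'a cpoly). Cst c * p" by (rule vector_space_cpoly)
  have "Var b \<in> homog B 1" if "b \<in> B" for b
    using that by (auto simp: Var_def homog_def poly_ring_def mon_deg_def)
  then show ?thesis
    unfolding lin_form_def
    by (intro subspace_sum[OF subspace_homog] subspace_scale[OF subspace_homog])
qed

lemma lin_form_basis:
  assumes "finite_dimensional_vector_space scale B" "b \<in> B"
  shows "lin_form scale B b = Var b"
proof -
  interpret finite_dimensional_vector_space scale B by fact
  have "Cst (representation B b b') * Var b' = (if b' = b then Var b' else 0)" for b'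
    by (simp add: representation_basis[OF independent_Basis \<open>b \<in> B\<close>])
  then show ?thesis using assms(2) finite_Basis by (simp add: lin_form_def)
qed

theorem sym_pow_UNIV:
  assumes "finite_dimensional_vector_space scale B"
  shows "sym_pow scale B d UNIV = homog B d"
proof
  interpret P: vector_space "\<lambda>c (p :: 'a cpoly). Cst c * p" by (rule vector_space_cpoly)
  have "(\<Prod>i<d. lin_form scale B (w i)) \<in> homog B d" for w
  proof (induction d)
    case 0
    show ?case by (auto simp: homog_def poly_ring_def mon_deg_def)
  next
    case (Suc d)
    then show ?case using homog_mult[OF Suc.IH lin_form_homog] by simp
  qed
  then show "sym_pow scale B d UNIV \<subseteq> homog B d"
    unfolding sym_pow_def by (intro P.span_minimal subspace_homog) auto
next
  interpret P: vector_space "\<lambda>c (p :: 'a cpoly). Cst c * p" by (rule vector_space_cpoly)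
  have mon: "\<exists>w. (\<forall>i<d. w i \<in> B) \<and>
      Poly_Mapping.single m (1::complex) = (\<Prod>i<d. lin_form scale B (w i))"
    if "Poly_Mapping.keys m \<subseteq> B" "mon_deg m = d" for m d
    using that
  proof (induction d arbitrary: m)
    case 0
    then have "m = 0"
      by (intro poly_mapping_eqI) (auto simp: mon_deg_def in_keys_iff)
    then show ?case by simp
  next
    case (Suc d)
    have "Poly_Mapping.keys m \<noteq> {}"
      using Suc.prems(2) by (auto simp: mon_deg_def)
    then obtain b where b: "b \<in> Poly_Mapping.keys m" by blast
    let ?e = "Poly_Mapping.single b (1::nat)"
    define n where "n = m - ?e"
    have m: "m = n + ?e" unfolding n_def
      using b by (intro poly_mapping_eqI)
        (auto simp: lookup_add lookup_minus lookup_single when_def in_keys_iff)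
    have "Poly_Mapping.keys n \<subseteq> B" using Suc.prems(1)
      by (auto simp: m in_keys_iff lookup_add)
    moreover have "mon_deg n = d"
      using Suc.prems(2) by (simp add: m mon_deg_plus) (simp add: mon_deg_def)
    ultimately obtain w where w: "\<forall>i<d. w i \<in> B"
      "Poly_Mapping.single n (1::complex) = (\<Prod>i<d. lin_form scale B (w i))"
      using Suc.IH by blast
    have "Poly_Mapping.single m (1::complex) = Poly_Mapping.single n 1 * lin_form scale B b"
      using lin_form_basis[OF assms, of b] b Suc.prems(1)
      by (auto simp: m Var_def mult_single)
    also have "\<dots> = (\<Prod>i<Suc d. lin_form scale B ((w(d := b)) i))"
      by (simp add: w(2))
    finally show ?case using w(1) b Suc.prems(1)
      by (intro exI[of _ "w(d := b)"]) (auto simp: less_Suc_eq)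
  qed
  show "homog B d \<subseteq> sym_pow scale B d UNIV"
  proof
    fix p assume p: "p \<in> homog B d"
    have "(\<Sum>m\<in>Poly_Mapping.keys p. Cst (Poly_Mapping.lookup p m) * Poly_Mapping.single m 1)
        \<in> sym_pow scale B d UNIV"
      unfolding sym_pow_def
    proof (intro P.span_sum P.span_scale P.span_base)
      fix m assume "m \<in> Poly_Mapping.keys p"
      then have "Poly_Mapping.keys m \<subseteq> B" "mon_deg m = d"
        using p by (auto simp: homog_def poly_ring_def)
      from mon[OF this] show "Poly_Mapping.single m 1 \<in>
          {\<Prod>i<d. lin_form scale B (w i) | w. \<forall>i<d. w i \<in> UNIV}" by auto
    qed
    then show "p \<in> sym_pow scale B d UNIV"
      by (simp add: Cst_times_single flip: poly_as_sum)
  qed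
qed

end

theory Submission
  imports Defs
begin

text \<open>
  Let \<open>F = F\<^sub>1 + F\<^sub>2\<close> with \<open>F\<^sub>i \<in> S\<^sup>dV\<^sub>i\<close> nonzero and \<open>V = V\<^sub>1 \<oplus> V\<^sub>2\<close>. The proof separates
  \<open>F\<^sup>\<bottom>\<close> from \<open>\<mm>F\<^sup>\<bottom>\<close> in degree \<open>d\<close> by means of \<open>F\<^sub>1\<close>: everything in \<open>\<mm>F\<^sup>\<bottom>\<close> annihilates
  \<open>F\<^sub>1\<close>, but some form of degree \<open>d\<close> in \<open>F\<^sup>\<bottom>\<close> does not.

  For the first claim, a linear functional on \<open>V\<close> is a constant-coefficient derivation of \<open>S\<close>.
  Each coordinate functional \<open>\<alpha>\<^sub>b\<close> is a sum \<open>\<xi>\<^sub>1 + \<xi>\<^sub>2\<close> where \<open>\<xi>\<^sub>i\<close> vanishes on \<open>V\<^sub>i\<close>, and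
  then \<open>\<xi>\<^sub>i \<circ> F\<^sub>i = 0\<close> by the product rule. If \<open>\<Theta> \<circ> F = 0\<close>, then \<open>\<Theta> \<circ> F\<^sub>1 = - \<Theta> \<circ> F\<^sub>2\<close> and
  so, \<open>T\<close> being commutative, both \<open>\<xi>\<^sub>1\<close> and \<open>\<xi>\<^sub>2\<close> annihilate \<open>\<Theta> \<circ> F\<^sub>1\<close>; hence so does
  \<open>\<alpha>\<^sub>b\<close>, which means that \<open>\<alpha>\<^sub>b\<Theta>\<close> annihilates \<open>F\<^sub>1\<close>. This is \<open>Var_act_vanishes\<close>.

  For the second claim, forms of degree \<open>d\<close> in \<open>T\<close> and \<open>S\<close> pair perfectly, the monomials being
  orthogonal. If \<open>F\<^sub>1\<close> and \<open>F\<^sub>2\<close> are linearly independent, some combination of two monomials of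
  \<open>T\<close> therefore annihilates \<open>F\<^sub>1 + F\<^sub>2\<close> but not \<open>F\<^sub>1\<close> (\<open>separating_form\<close>). They are independent:
  if \<open>F\<^sub>2\<close> were a multiple of \<open>F\<^sub>1\<close>, both \<open>\<xi>\<^sub>1\<close> and \<open>\<xi>\<^sub>2\<close> would annihilate \<open>F\<^sub>2\<close>, so all partial
  derivatives of \<open>F\<^sub>2\<close> would be zero, which is impossible for a nonzero form of degree \<open>d \<ge> 1\<close>.
\<close>

section \<open>Linear functionals as derivations\<close>

definition linear_op :: "'v set \<Rightarrow> ('v \<Rightarrow> complex) \<Rightarrow> 'v cpoly"
  where "linear_op B c = (\<Sum>b\<in>B. Cst (c b) * Var b)"

lemma act_linear_op: "linear_op B c \<bullet>\<^sub>T F = (\<Sum>b\<in>B. Cst (c b) * pd b F)"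
  by (simp add: linear_op_def act_sum_left act_mult act_Cst act_Var)

lemma linear_op_product_rule:
  "linear_op B c \<bullet>\<^sub>T (F * G) = (linear_op B c \<bullet>\<^sub>T F) * G + F * (linear_op B c \<bullet>\<^sub>T G)"
  by (simp add: act_linear_op pd_mult algebra_simps sum.distrib sum_distrib_left sum_distrib_right)

lemma pd_one: "pd i 1 = 0"
  using pd_single[of i 0 1] by simp

lemma act_commute: "\<Theta> \<bullet>\<^sub>T \<Psi> \<bullet>\<^sub>T F = \<Psi> \<bullet>\<^sub>T \<Theta> \<bullet>\<^sub>T F"
  by (metis act_mult mult.commute)

lemma act_minus_left: "(- \<Theta>) \<bullet>\<^sub>T F = - (\<Theta> \<bullet>\<^sub>T F)"
  using act_add_left[of \<Theta> "- \<Theta>" F] by (simp add: add_eq_0_iff)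

lemma linear_op_lin_form:
  assumes "finite B"
  shows "linear_op B c \<bullet>\<^sub>T lin_form scale B v = Cst (\<Sum>b\<in>B. c b * module.representation scale B v b)"
proof -
  have Cst_sum: "Cst (sum f B) = (\<Sum>b\<in>B. Cst (f b))" for f :: "'a \<Rightarrow> complex"
    by (induction B rule: infinite_finite_induct) (simp_all add: Cst_add)
  have "pd b (lin_form scale B v) = Cst (module.representation scale B v b)" if "b \<in> B" for b
  proof -
    have "pd b (lin_form scale B v) =
        (\<Sum>b'\<in>B. if b = b' then Cst (module.representation scale B v b') else 0)"
      unfolding lin_form_def pd_sum pd_Cst_times pd_Var by (rule sum.cong) auto
    then show ?thesis using assms that by simp
  qed
  then show ?thesis by (simp add: act_linear_op Cst_sum Cst_mult)
qed

lemma linear_op_kills_sym_pow: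
  assumes W: "\<And>w. w \<in> W \<Longrightarrow> linear_op B c \<bullet>\<^sub>T lin_form scale B w = 0"
    and F: "F \<in> sym_pow scale B d W"
  shows "linear_op B c \<bullet>\<^sub>T F = 0"
proof -
  interpret P: vector_space "\<lambda>c (p :: 'a cpoly). Cst c * p" by (rule vector_space_cpoly)
  have "linear_op B c \<bullet>\<^sub>T (\<Prod>i<d. lin_form scale B (w i)) = 0" if "\<forall>i<d. w i \<in> W" for w
    using that
  proof (induction d)
    case 0
    then show ?case by (simp add: act_linear_op pd_one)
  next
    case (Suc d)
    then show ?case by (simp add: linear_op_product_rule W)
  qed
  moreover have "P.subspace {G. linear_op B c \<bullet>\<^sub>T G = 0}"
    by (rule P.subspaceI) (auto simp: act_add_right act_Cst_right)
  ultimately have "sym_pow scale B d W \<subseteq> {G. linear_op B c \<bullet>\<^sub>T G = 0}"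
    unfolding sym_pow_def by (intro P.span_minimal) auto
  with F show ?thesis by blast
qed

section \<open>Splitting the coordinate functionals\<close>

text \<open>
  The functionals are \<open>\<alpha>\<^sub>b\<close> composed with the projections of \<open>V = V\<^sub>1 \<oplus> V\<^sub>2\<close> to \<open>V\<^sub>2\<close> and to
  \<open>V\<^sub>1\<close>. It is enough to know the projections on the basis vectors.
\<close>

lemma split_coordinate:
  assumes fd: "finite_dimensional_vector_space scale B"
    and V: "module.subspace scale V1" "module.subspace scale V2" "V1 \<inter> V2 = {0}"
      "{v1 + v2 | v1 v2. v1 \<in> V1 \<and> v2 \<in> V2} = UNIV"
    and b: "b \<in> B"
  obtains c1 c2 where "Var b = linear_op B c1 + linear_op B c2"
    "\<And>v. v \<in> V1 \<Longrightarrow> linear_op B c1 \<bullet>\<^sub>T lin_form scale B v = 0"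
    "\<And>v. v \<in> V2 \<Longrightarrow> linear_op B c2 \<bullet>\<^sub>T lin_form scale B v = 0"
proof -
  interpret finite_dimensional_vector_space scale B by fact
  have "\<forall>v. \<exists>v1 v2. v = v1 + v2 \<and> v1 \<in> V1 \<and> v2 \<in> V2"
    using V(4) by blast
  then obtain p1 p2 where p: "\<And>v. v = p1 v + p2 v" "\<And>v. p1 v \<in> V1" "\<And>v. p2 v \<in> V2"
    by metis
  have repr: "(\<Sum>x\<in>B. scale (representation B v x) x) = v" for v
    by (rule sum_representation_eq) (simp_all add: independent_Basis finite_Basis span_Basis)
  have sum_p: "v = (\<Sum>x\<in>B. scale (representation B v x) (p1 x)) + (\<Sum>x\<in>B. scale (representation B v x) (p2 x))"
    for v
    by (subst repr[of v, symmetric]) (simp flip: sum.distrib scale_right_distrib p(1))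
  have in1: "(\<Sum>x\<in>B. scale (representation B v x) (p1 x)) \<in> V1" for v
    by (intro subspace_sum[OF V(1)] subspace_scale[OF V(1)] p)
  have in2: "(\<Sum>x\<in>B. scale (representation B v x) (p2 x)) \<in> V2" for v
    by (intro subspace_sum[OF V(2)] subspace_scale[OF V(2)] p)
  have z1: "(\<Sum>x\<in>B. scale (representation B v x) (p2 x)) = 0" if "v \<in> V1" for v
  proof -
    have "(\<Sum>x\<in>B. scale (representation B v x) (p2 x)) = v - (\<Sum>x\<in>B. scale (representation B v x) (p1 x))"
      using sum_p[of v] by (simp add: eq_diff_eq add.commute)
    then have "(\<Sum>x\<in>B. scale (representation B v x) (p2 x)) \<in> V1"
      using subspace_diff[OF V(1) that in1] by simp
    with in2 V(3) show ?thesis by blast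
  qed
  have z2: "(\<Sum>x\<in>B. scale (representation B v x) (p1 x)) = 0" if "v \<in> V2" for v
  proof -
    have "(\<Sum>x\<in>B. scale (representation B v x) (p1 x)) = v - (\<Sum>x\<in>B. scale (representation B v x) (p2 x))"
      using sum_p[of v] by (simp add: eq_diff_eq)
    then have "(\<Sum>x\<in>B. scale (representation B v x) (p1 x)) \<in> V2"
      using subspace_diff[OF V(2) that in2] by simp
    with in1 V(3) show ?thesis by blast
  qed
  have lin: "linear_op B (\<lambda>x. representation B (q x) b) \<bullet>\<^sub>T lin_form scale B v =
      Cst (representation B (\<Sum>x\<in>B. scale (representation B v x) (q x)) b)" for q v
    using finite_Basis independent_Basis span_Basis
    by (simp add: linear_op_lin_form representation_sum representation_scale mult.commute)
  show thesis
  proof (rule that)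
    have "representation B (p2 x) b + representation B (p1 x) b = (if x = b then 1 else 0)"
      if "x \<in> B" for x
    proof -
      have "representation B (p2 x) b + representation B (p1 x) b = representation B (p1 x + p2 x) b"
        using independent_Basis span_Basis by (simp add: representation_add)
      then show ?thesis
        using that by (simp add: representation_basis[OF independent_Basis] flip: p(1))
    qed
    then have "linear_op B (\<lambda>x. representation B (p2 x) b) + linear_op B (\<lambda>x. representation B (p1 x) b)
        = (\<Sum>x\<in>B. if x = b then Var x else 0)"
      unfolding linear_op_def
      by (simp flip: sum.distrib distrib_right Cst_add) (intro sum.cong, auto)
    then show "Var b = linear_op B (\<lambda>x. representation B (p2 x) b) +
        linear_op B (\<lambda>x. representation B (p1 x) b)"
      using finite_Basis b by simp
  qed (simp_all add: lin z1 z2 representation_zero)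
qed

text \<open>
  Functionals that vanish on \<open>V\<^sub>1\<close> annihilate the left side of the equation between \<open>F\<^sub>1\<close> and
  \<open>F\<^sub>2\<close>, those that vanish on \<open>V\<^sub>2\<close> annihilate the right side, and \<open>\<alpha>\<^sub>b\<close> is a sum of two such
  functionals. With \<open>\<Theta> \<in> F\<^sup>\<bottom>\<close> and \<open>\<Psi> = - \<Theta>\<close> this gives \<open>\<mm>F\<^sup>\<bottom> \<subseteq> F\<^sub>1\<^sup>\<bottom>\<close>; with constant \<open>\<Theta>\<close> and
  \<open>\<Psi>\<close> it gives the linear independence of \<open>F\<^sub>1\<close> and \<open>F\<^sub>2\<close>.
\<close>

lemma Var_act_vanishes:
  assumes fd: "finite_dimensional_vector_space scale B"
    and V: "module.subspace scale V1" "module.subspace scale V2" "V1 \<inter> V2 = {0}"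
      "{v1 + v2 | v1 v2. v1 \<in> V1 \<and> v2 \<in> V2} = UNIV"
    and F: "F1 \<in> sym_pow scale B d V1" "F2 \<in> sym_pow scale B d V2"
    and eq: "\<Theta> \<bullet>\<^sub>T F1 = \<Psi> \<bullet>\<^sub>T F2"
    and b: "b \<in> B"
  shows "Var b \<bullet>\<^sub>T \<Theta> \<bullet>\<^sub>T F1 = 0"
proof -
  obtain c1 c2 where c: "Var b = linear_op B c1 + linear_op B c2"
    "\<And>v. v \<in> V1 \<Longrightarrow> linear_op B c1 \<bullet>\<^sub>T lin_form scale B v = 0"
    "\<And>v. v \<in> V2 \<Longrightarrow> linear_op B c2 \<bullet>\<^sub>T lin_form scale B v = 0"
    using split_coordinate[OF fd V b] by blast
  have "linear_op B c1 \<bullet>\<^sub>T \<Theta> \<bullet>\<^sub>T F1 = 0"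
    using linear_op_kills_sym_pow[OF c(2) F(1)] act_commute[of "linear_op B c1" \<Theta> F1] by simp
  moreover have "linear_op B c2 \<bullet>\<^sub>T \<Theta> \<bullet>\<^sub>T F1 = 0"
    using linear_op_kills_sym_pow[OF c(3) F(2)] act_commute[of "linear_op B c2" \<Psi> F2]
    by (simp add: eq)
  ultimately show ?thesis by (simp add: c(1) act_add_left)
qed

section \<open>The pairing of forms of equal degree\<close>

lemma mon_deg_single: "mon_deg (Poly_Mapping.single i n) = n"
  by (simp add: mon_deg_def)

lemma pd_homog:
  assumes "G \<in> homog B (Suc k)"
  shows "pd i G \<in> homog B k"
proof -
  have "Poly_Mapping.keys m \<subseteq> B \<and> mon_deg m = k" if "m \<in> Poly_Mapping.keys (pd i G)" for m
  proof -
    have m: "m + Poly_Mapping.single i 1 \<in> Poly_Mapping.keys G"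
      using that by (auto simp: in_keys_iff lookup_pd)
    then have "Poly_Mapping.keys (m + Poly_Mapping.single i 1) \<subseteq> B"
      "mon_deg (m + Poly_Mapping.single i 1) = Suc k"
      using assms by (auto simp: homog_def poly_ring_def)
    then show ?thesis
      by (auto simp: mon_deg_plus in_keys_iff lookup_add mon_deg_single)
  qed
  then show ?thesis by (auto simp: homog_def poly_ring_def)
qed

lemma mon_deg_eq_0_iff: "mon_deg m = 0 \<longleftrightarrow> m = 0"
proof
  assume "mon_deg m = 0"
  then show "m = 0"
    by (intro poly_mapping_eqI) (auto simp: mon_deg_def in_keys_iff)
qed (simp add: mon_deg_def)

lemma minus_single_plus:
  "b \<in> Poly_Mapping.keys m \<Longrightarrow>
    m = (m - Poly_Mapping.single b (1::nat)) + Poly_Mapping.single b 1"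
  by (intro poly_mapping_eqI)
     (auto simp: lookup_add lookup_minus lookup_single when_def in_keys_iff)

text \<open>The constant is the product of the factorials of the exponents of \<open>m\<close>.\<close>

lemma mon_act_homog:
  "\<exists>a\<noteq>0. \<forall>G\<in>homog B (mon_deg m). mon_act m G = Cst (a * Poly_Mapping.lookup G m)"
proof (induction "mon_deg m" arbitrary: m)
  case 0
  then have m: "m = 0" by (simp add: mon_deg_eq_0_iff)
  have "G = Cst (Poly_Mapping.lookup G 0)" if "G \<in> homog B 0" for G
    using that by (intro poly_mapping_eqI)
      (auto simp: Cst_def lookup_single when_def homog_def mon_deg_eq_0_iff in_keys_iff)
  then show ?case
    by (intro exI[of _ 1]) (auto simp: m mon_deg_def)
next
  case (Suc k)
  then have "m \<noteq> 0" using mon_deg_eq_0_iff[of m] by auto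
  then obtain b where b: "b \<in> Poly_Mapping.keys m" by (metis keys_eq_empty ex_in_conv)
  define n where "n = m - Poly_Mapping.single b 1"
  have m: "m = n + Poly_Mapping.single b 1"
    unfolding n_def by (rule minus_single_plus[OF b])
  have n: "k = mon_deg n"
    using Suc.hyps(2) by (simp add: m mon_deg_plus mon_deg_single)
  obtain a where a: "a \<noteq> 0"
    "\<And>G. G \<in> homog B k \<Longrightarrow> mon_act n G = Cst (a * Poly_Mapping.lookup G n)"
    using Suc.hyps(1)[OF n] n by blast
  have "mon_act m G = Cst (a * of_nat (Suc (Poly_Mapping.lookup n b)) * Poly_Mapping.lookup G m)"
    if "G \<in> homog B (mon_deg m)" for G
  proof -
    have "mon_act m G = mon_act n (pd b G)"
      by (simp only: m mon_act_plus mon_act_single)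
    also have "\<dots> = Cst (a * Poly_Mapping.lookup (pd b G) n)"
      using a(2)[OF pd_homog] that Suc.hyps(2) by simp
    finally show ?thesis by (simp only: lookup_pd m mult.assoc)
  qed
  then show ?case
    using a(1) by (intro exI[of _ "a * of_nat (Suc (Poly_Mapping.lookup n b))"])
      (auto simp del: of_nat_Suc)
qed

text \<open>
  The witness is \<open>F\<^sub>n \<alpha>\<^sup>m / m! - F\<^sub>m \<alpha>\<^sup>n / n!\<close> for \<open>F = F\<^sub>1 + F\<^sub>2\<close>, whose pairing with \<open>F\<close> is
  \<open>F\<^sub>n F\<^sub>m - F\<^sub>m F\<^sub>n\<close> and whose pairing with \<open>F\<^sub>1\<close> is a minor of the coefficient matrix of
  \<open>F\<^sub>1\<close> and \<open>F\<^sub>2\<close>.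
\<close>

lemma separating_form:
  assumes F: "F1 \<in> homog B d" "F2 \<in> homog B d" "F1 \<noteq> 0"
    and indep: "\<And>c. F2 \<noteq> Cst c * F1"
  obtains \<Delta> where "\<Delta> \<in> homog B d" "\<Delta> \<bullet>\<^sub>T (F1 + F2) = 0" "\<Delta> \<bullet>\<^sub>T F1 \<noteq> 0"
proof -
  let ?l = Poly_Mapping.lookup
  obtain n where n: "?l F1 n \<noteq> 0"
    using F(3) by (metis poly_mapping_eqI lookup_zero)
  obtain m where m: "?l F2 m \<noteq> ?l F2 n / ?l F1 n * ?l F1 m"
    using indep[of "?l F2 n / ?l F1 n"] by (metis poly_mapping_eqI lookup_Cst_times)
  have "n \<in> Poly_Mapping.keys F1" "m \<in> Poly_Mapping.keys F1 \<or> m \<in> Poly_Mapping.keys F2"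
    using n m by (auto simp: in_keys_iff)
  then have deg: "mon_deg m = d" "mon_deg n = d"
    and keys: "Poly_Mapping.keys m \<subseteq> B" "Poly_Mapping.keys n \<subseteq> B"
    using F by (auto simp: homog_def poly_ring_def)
  obtain a where a: "a \<noteq> 0" "\<And>G. G \<in> homog B d \<Longrightarrow> mon_act m G = Cst (a * ?l G m)"
    using mon_act_homog[of B m, unfolded deg] by blast
  obtain a' where a': "a' \<noteq> 0" "\<And>G. G \<in> homog B d \<Longrightarrow> mon_act n G = Cst (a' * ?l G n)"
    using mon_act_homog[of B n, unfolded deg] by blast
  interpret P: vector_space "\<lambda>c (p :: 'a cpoly). Cst c * p" by (rule vector_space_cpoly)
  define x where "x = ?l F1 n + ?l F2 n"
  define y where "y = ?l F1 m + ?l F2 m"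
  define \<Delta> where "\<Delta> = Poly_Mapping.single m (x / a) + Poly_Mapping.single n (- y / a')"
  have single: "Poly_Mapping.single k z \<in> homog B d" if "mon_deg k = d" "Poly_Mapping.keys k \<subseteq> B"
    for k and z :: complex
    using that by (auto simp: homog_def poly_ring_def)
  have act: "\<Delta> \<bullet>\<^sub>T G = Cst (x * ?l G m - y * ?l G n)" if "G \<in> homog B d" for G
  proof -
    have "\<Delta> \<bullet>\<^sub>T G = Cst (x / a * (a * ?l G m) + - y / a' * (a' * ?l G n))"
      by (simp only: \<Delta>_def act_add_left act_single a(2)[OF that] a'(2)[OF that] Cst_add Cst_mult)
    then show ?thesis using a(1) a'(1) by simp
  qed
  show thesis
  proof (rule that)
    show "\<Delta> \<in> homog B d"
      unfolding \<Delta>_def by (intro P.subspace_add[OF subspace_homog] single deg keys)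
    have "\<Delta> \<bullet>\<^sub>T (F1 + F2) = Cst (x * y - y * x)"
      using act[OF P.subspace_add[OF subspace_homog F(1,2)]] by (simp add: lookup_add x_def y_def)
    then show "\<Delta> \<bullet>\<^sub>T (F1 + F2) = 0" by (simp add: mult.commute)
    have "x * ?l F1 m - y * ?l F1 n \<noteq> 0"
      using m n by (simp add: x_def y_def field_simps)
    then show "\<Delta> \<bullet>\<^sub>T F1 \<noteq> 0"
      unfolding act[OF F(1)] Cst_def by (metis lookup_single_eq lookup_zero)
  qed
qed

lemma homog_eq_0_if_pd_eq_0:
  assumes G: "G \<in> homog B d" "d \<ge> 1" and pd: "\<And>b. b \<in> B \<Longrightarrow> pd b G = 0"
  shows "G = 0"
proof (rule ccontr)
  assume "G \<noteq> 0"
  then obtain m where m: "m \<in> Poly_Mapping.keys G" by (metis keys_eq_empty ex_in_conv)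
  then have "mon_deg m = d" and B: "Poly_Mapping.keys m \<subseteq> B"
    using G(1) by (auto simp: homog_def poly_ring_def)
  then have "m \<noteq> 0" using G(2) mon_deg_eq_0_iff[of m] by auto
  then obtain b where b: "b \<in> Poly_Mapping.keys m" by (metis keys_eq_empty ex_in_conv)
  let ?n = "m - Poly_Mapping.single b 1"
  have "Poly_Mapping.lookup (pd b G) ?n \<noteq> 0"
    using m unfolding lookup_pd minus_single_plus[OF b, symmetric]
    by (simp add: in_keys_iff del: of_nat_Suc)
  then show False using pd b B by auto
qed

lemma sym_pow_subset_homog:
  assumes "finite_dimensional_vector_space scale B"
  shows "sym_pow scale B d W \<subseteq> homog B d"
proof -
  interpret P: vector_space "\<lambda>c (p :: 'a cpoly). Cst c * p" by (rule vector_space_cpoly)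
  have "sym_pow scale B d W \<subseteq> sym_pow scale B d UNIV"
    unfolding sym_pow_def by (rule P.span_mono) auto
  then show ?thesis by (simp add: sym_pow_UNIV[OF assms])
qed

section \<open>Direct sums\<close>

lemma m_times_subset_apolar:
  assumes I: "ideal I (poly_ring B)"
    and kill: "\<And>b \<Theta>. b \<in> B \<Longrightarrow> \<Theta> \<in> I \<Longrightarrow> Var b \<bullet>\<^sub>T \<Theta> \<bullet>\<^sub>T G = 0"
  shows "m_times B I \<subseteq> apolar B G"
proof
  interpret cring "poly_ring B" by (rule cring_poly_ring)
  have Vars: "Var ` B \<subseteq> carrier (poly_ring B)"
    by (auto simp: Var_def poly_ring_def)
  have IC: "I \<subseteq> carrier (poly_ring B)"
    using ideal.Icarr[OF I] by blast
  \<comment> \<open>The annihilator of \<open>\<Theta> \<bullet>\<^sub>T G\<close> is an ideal, so it is enough that it contains the generators.\<close>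
  have irr: "irr_ideal B \<subseteq> apolar B (\<Theta> \<bullet>\<^sub>T G)" if "\<Theta> \<in> I" for \<Theta>
    unfolding irr_ideal_def
    using Vars kill that by (intro genideal_minimal ideal_apolar) (auto simp: apolar_def)
  fix x assume "x \<in> m_times B I"
  then show "x \<in> apolar B G"
  proof (induction rule: ideal_prod.induct)
    case (prod i j)
    then have "i \<in> carrier (poly_ring B)" "i \<bullet>\<^sub>T j \<bullet>\<^sub>T G = 0"
      using irr by (auto simp: apolar_def)
    with prod IC show ?case
      using m_closed[of i j] by (auto simp: apolar_def poly_ring_simps act_mult)
  next
    case (sum s1 s2)
    then show ?case
      using additive_subgroup.a_closed[OF ideal.axioms(1)[OF ideal_apolar]] by blast
  qed
qed

lemma has_minimal_generatorI:
  assumes I: "ideal I (poly_ring B)" and \<Theta>: "\<Theta> \<in> I" "\<Theta> \<in> homog B k" "\<Theta> \<notin> m_times B I"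
  shows "has_minimal_generator B I k"
proof -
  interpret cring "poly_ring B" by (rule cring_poly_ring)
  have "ideal (irr_ideal B) (poly_ring B)"
    unfolding irr_ideal_def by (rule genideal_ideal) (auto simp: Var_def poly_ring_def)
  then have M: "ideal (m_times B I) (poly_ring B)"
    using I by (rule ideal_prod_is_ideal)
  have "\<Theta> \<in> m_times B I +>\<^bsub>poly_ring B\<^esub> \<Theta>"
    using \<Theta>(1) ideal.Icarr[OF I] additive_subgroup.zero_closed[OF ideal.axioms(1)[OF M]]
    by (force simp: a_r_coset_def' poly_ring_simps)
  then have "m_times B I +>\<^bsub>poly_ring B\<^esub> \<Theta> \<noteq> \<zero>\<^bsub>poly_ring B Quot m_times B I\<^esub>"
    using \<Theta>(3) by (auto simp: FactRing_def)
  then show ?thesis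
    using \<Theta>(1,2) by (auto simp: has_minimal_generator_def gen_space_def)
qed

theorem theorem1p1:
  fixes scale :: "complex \<Rightarrow> 'v::ab_group_add \<Rightarrow> 'v"
    and B :: "'v set" and d :: nat and F :: "'v cpoly"
  assumes "finite_dimensional_vector_space scale B"
    and "d \<ge> 1"
    and "F \<in> sym_pow scale B d UNIV"
    and "is_direct_sum scale B d F"
  shows "has_minimal_generator B (apolar B F) d"
proof -
  obtain V1 V2 F1 F2 where V: "module.subspace scale V1" "module.subspace scale V2" "V1 \<inter> V2 = {0}"
      "{v1 + v2 | v1 v2. v1 \<in> V1 \<and> v2 \<in> V2} = UNIV"
    and F1: "F1 \<in> sym_pow scale B d V1" "F1 \<noteq> 0" and F2: "F2 \<in> sym_pow scale B d V2" "F2 \<noteq> 0"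
    and F: "F = F1 + F2"
    using assms(4) unfolding is_direct_sum_def by blast
  note vanish = Var_act_vanishes[OF assms(1) V F1(1) F2(1)]
  have h: "F1 \<in> homog B d" "F2 \<in> homog B d"
    using sym_pow_subset_homog[OF assms(1)] F1 F2 by blast+
  have indep: "F2 \<noteq> Cst c * F1" for c
  proof
    assume c: "F2 = Cst c * F1"
    have "pd b F2 = 0" if "b \<in> B" for b
      using vanish[of "Cst c" 1 b] that by (simp add: act_Cst act_Var c)
    then show False
      using homog_eq_0_if_pd_eq_0[OF h(2) assms(2)] F2(2) by blast
  qed
  obtain \<Delta> where \<Delta>: "\<Delta> \<in> homog B d" "\<Delta> \<bullet>\<^sub>T F = 0" "\<Delta> \<bullet>\<^sub>T F1 \<noteq> 0"
    using separating_form[OF h F1(2) indep] F by blast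
  have "Var b \<bullet>\<^sub>T \<Theta> \<bullet>\<^sub>T F1 = 0" if "b \<in> B" "\<Theta> \<in> apolar B F" for b \<Theta>
  proof (rule vanish[OF _ \<open>b \<in> B\<close>])
    have "\<Theta> \<bullet>\<^sub>T F1 + \<Theta> \<bullet>\<^sub>T F2 = 0"
      using that(2) by (simp add: apolar_def F act_add_right)
    then show "\<Theta> \<bullet>\<^sub>T F1 = (- \<Theta>) \<bullet>\<^sub>T F2"
      by (simp add: act_minus_left eq_neg_iff_add_eq_0)
  qed
  then have "m_times B (apolar B F) \<subseteq> apolar B F1"
    by (rule m_times_subset_apolar[OF ideal_apolar])
  with \<Delta>(3) have "\<Delta> \<notin> m_times B (apolar B F)"
    by (auto simp: apolar_def)
  moreover have "\<Delta> \<in> apolar B F"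
    using \<Delta>(1,2) by (simp add: apolar_def homog_def)
  ultimately show ?thesis
    using \<Delta>(1) by (intro has_minimal_generatorI[OF ideal_apolar])
qed

end
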